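(* Let $(X,d)$ be a metric space together with a directed structure $\vec{P}(X)$ all of whose paths are rectifiable. Then the zigzag distance $d_{zz}$ on $\vec{X}=(X,\vec{P}(X))$ induced by $d$ and $\vec{P}(X)$ is an extended metric.
   Context: Let $I=[0,1]$. A path in a topological space $X$ is a continuous map $I\to X$. A directed structure (d-structure) on $X$ is a set $\vec{P}(X)$ of paths that contains all constant paths and is closed under reparametrization (precomposition with a nondecreasing continuous surjection $h\colon I\to I$), under taking subpaths (restrictions to $[a,b]\subseteq I$ linearly rescaled to have domain $I$), and under concatenation of paths $\gamma,\gamma'$ with $\gamma(1)=\gamma'(0)$. Its elements are called d-paths; $\vec{P}(x,x')$ is the set of d-paths from $x$ to $x'$. For a metric space $(X,d)$ (with the metric topology), the length of a path $\gamma$ is $\mathrm{len}(\gamma)=\sup\sum_{i=1}^N d(\gamma(t_{i-1}),\gamma(t_i))$ over all $N$ and $0\le t_0<\dots<t_N\le 1$; $\gamma$ is rectifiable if $\mathrm{len}(\gamma)<\infty$. A zigzag path between $x$ and $x'$ is a finite sequence $\gamma=(\gamma_i)_{i=1}^m$ of d-paths with $\gamma_i\in\vec{P}(p_{i-1},p_i)\cup\vec{P}(p_i,p_{i-1})$, $p_0=x$, $p_m=x'$; its length is $l_{zz}(\gamma)=\sum_i\mathrm{len}(\gamma_i)$. The zigzag distance $d_{zz}(x,x')$ is the infimum of $l_{zz}(\gamma)$ over all zigzag paths between $x$ and $x'$ ($\infty$ if there are none). An extended metric satisfies all the axioms of a metric (including $d(x,x')=0\Rightarrow x=x'$) except that it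 may take the value $\infty$. *)

theory Defs
  imports "HOL-Analysis.Analysis"
begin

text \<open>
  A map \<open>I \<rightarrow> X\<close> on the unit interval is represented by the unique function on the reals that
  agrees with it on \<open>{0..1}\<close> and is \<^const>\<open>undefined\<close> elsewhere, so that equality of
  representatives is equality of maps on \<open>I\<close>.
\<close>

definition paths :: "'a topology \<Rightarrow> (real \<Rightarrow> 'a) set" where
  "paths X = {\<gamma> \<in> extensional {0..1}. pathin X \<gamma>}"

definition reparametrization :: "(real \<Rightarrow> real) \<Rightarrow> bool" where
  "reparametrization h \<longleftrightarrow>
     continuous_on {0..1} h \<and> mono_on {0..1} h \<and> h ` {0..1} = {0..1}"

definition rescaled_subpath :: "real \<Rightarrow> real \<Rightarrow> (real \<Rightarrow> 'a) \<Rightarrow> real \<Rightarrow> 'a" where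
  "rescaled_subpath a b \<gamma> = (\<lambda>t\<in>{0..1}. \<gamma> (a + (b - a) * t))"

definition concat_path :: "(real \<Rightarrow> 'a) \<Rightarrow> (real \<Rightarrow> 'a) \<Rightarrow> real \<Rightarrow> 'a" where
  "concat_path \<gamma> \<gamma>' = (\<lambda>t\<in>{0..1}. if t \<le> 1/2 then \<gamma> (2 * t) else \<gamma>' (2 * t - 1))"

locale directed_structure =
  fixes X :: "'a topology" and P :: "(real \<Rightarrow> 'a) set"
  assumes dpaths_are_paths: "P \<subseteq> paths X"
    and constant_paths: "x \<in> topspace X \<Longrightarrow> (\<lambda>t\<in>{0..1}. x) \<in> P"
    and reparametrized: "\<gamma> \<in> P \<Longrightarrow> reparametrization h \<Longrightarrow> compose {0..1} \<gamma> h \<in> P"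
    and subpaths: "\<gamma> \<in> P \<Longrightarrow> 0 \<le> a \<Longrightarrow> a \<le> b \<Longrightarrow> b \<le> 1 \<Longrightarrow> rescaled_subpath a b \<gamma> \<in> P"
    and concatenated: "\<gamma> \<in> P \<Longrightarrow> \<gamma>' \<in> P \<Longrightarrow> \<gamma> 1 = \<gamma>' 0 \<Longrightarrow> concat_path \<gamma> \<gamma>' \<in> P"

definition dpaths_between :: "(real \<Rightarrow> 'a) set \<Rightarrow> 'a \<Rightarrow> 'a \<Rightarrow> (real \<Rightarrow> 'a) set" where
  "dpaths_between P x x' = {\<gamma> \<in> P. \<gamma> 0 = x \<and> \<gamma> 1 = x'}"

definition path_len :: "('a \<Rightarrow> 'a \<Rightarrow> real) \<Rightarrow> (real \<Rightarrow> 'a) \<Rightarrow> ennreal" where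
  "path_len d \<gamma> =
     (SUP (N, t) \<in> {(N :: nat, t :: nat \<Rightarrow> real). strict_mono_on {0..N} t \<and> 0 \<le> t 0 \<and> t N \<le> 1}.
        ennreal (\<Sum>i=1..N. d (\<gamma> (t (i - 1))) (\<gamma> (t i))))"

definition rectifiable :: "('a \<Rightarrow> 'a \<Rightarrow> real) \<Rightarrow> (real \<Rightarrow> 'a) \<Rightarrow> bool" where
  "rectifiable d \<gamma> \<longleftrightarrow> path_len d \<gamma> < \<infinity>"

text \<open>The \<open>i\<close>-th d-path of the sequence, counting from 1, is \<open>\<gamma>s ! (i - 1)\<close>.\<close>

definition zigzag_path :: "(real \<Rightarrow> 'a) set \<Rightarrow> 'a \<Rightarrow> 'a \<Rightarrow> (real \<Rightarrow> 'a) list \<Rightarrow> bool" where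
  "zigzag_path P x x' \<gamma>s \<longleftrightarrow> \<gamma>s \<noteq> [] \<and>
     (\<exists>p :: nat \<Rightarrow> 'a. p 0 = x \<and> p (length \<gamma>s) = x' \<and>
        (\<forall>i\<in>{1..length \<gamma>s}. \<gamma>s ! (i - 1) \<in>
           dpaths_between P (p (i - 1)) (p i) \<union> dpaths_between P (p i) (p (i - 1))))"

definition zigzag_len :: "('a \<Rightarrow> 'a \<Rightarrow> real) \<Rightarrow> (real \<Rightarrow> 'a) list \<Rightarrow> ennreal" where
  "zigzag_len d \<gamma>s = (\<Sum>\<gamma>\<leftarrow>\<gamma>s. path_len d \<gamma>)"

text \<open>The infimum of the empty set in \<^typ>\<open>ennreal\<close> is \<open>\<infinity>\<close>.\<close>

definition zigzag_dist ::
  "('a \<Rightarrow> 'a \<Rightarrow> real) \<Rightarrow> (real \<Rightarrow> 'a) set \<Rightarrow> 'a \<Rightarrow> 'a \<Rightarrow> ennreal" where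
  "zigzag_dist d P x x' = (INF \<gamma>s \<in> {\<gamma>s. zigzag_path P x x' \<gamma>s}. zigzag_len d \<gamma>s)"

text \<open>Nonnegativity is part of the type \<^typ>\<open>ennreal\<close>.\<close>

locale extended_metric =
  fixes M :: "'a set" and \<delta> :: "'a \<Rightarrow> 'a \<Rightarrow> ennreal"
  assumes zero: "x \<in> M \<Longrightarrow> y \<in> M \<Longrightarrow> \<delta> x y = 0 \<longleftrightarrow> x = y"
    and commute: "x \<in> M \<Longrightarrow> y \<in> M \<Longrightarrow> \<delta> x y = \<delta> y x"
    and triangle: "x \<in> M \<Longrightarrow> y \<in> M \<Longrightarrow> z \<in> M \<Longrightarrow> \<delta> x z \<le> \<delta> x y + \<delta> y z"

end

theory Submission
  imports Defs
begin

text \<open>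
  Symmetry and the triangle inequality come from reversing and concatenating zigzag paths. Since the
  length of a path is at least the distance of its endpoints, \<open>d \<le> d\<^sub>z\<^sub>z\<close>, which gives definiteness.
\<close>

context Metric_space
begin

text \<open>The partition consisting of 0 and 1 alone contributes exactly this distance to the
  supremum.\<close>

lemma path_len_ge_dist: "ennreal (d (\<gamma> 0) (\<gamma> 1)) \<le> path_len d \<gamma>"
proof -
  have "strict_mono_on {0..1} (real :: nat \<Rightarrow> real)"
    by (auto simp: strict_mono_on_def)
  then show ?thesis
    unfolding path_len_def by (intro SUP_upper2[where i = "(1, real)"]) auto
qed

lemma path_len_constant:
  assumes "x \<in> M"
  shows "path_len d (\<lambda>t\<in>{0..1}. x) = 0"
proof -
  have "(\<Sum>i=1..N. d ((\<lambda>t\<in>{0..1}. x) (t (i - 1))) ((\<lambda>t\<in>{0..1}. x) (t i))) = 0"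
    if "strict_mono_on {0..N} t" "0 \<le> t 0" "t N \<le> 1" for N :: nat and t :: "nat \<Rightarrow> real"
  proof -
    \<comment> \<open>Outside \<open>{0..1}\<close> the restricted function is
      \<open>undefined\<close>, which may lie outside \<open>M\<close>, so every sample point has to
      be confined to the interval first.\<close>
    have "t i \<in> {0..1}" if "i \<le> N" for i
    proof -
      have "t 0 \<le> t i" "t i \<le> t N"
        using that monotone_onD[OF strict_mono_on_imp_mono_on[OF \<open>strict_mono_on {0..N} t\<close>]] by auto
      with \<open>0 \<le> t 0\<close> \<open>t N \<le> 1\<close> show ?thesis by auto
    qed
    then show ?thesis
      using assms by (intro sum.neutral) auto
  qed
  then show ?thesis
    unfolding path_len_def by (intro antisym SUP_least) auto
qed

text \<open>Places the nodes of a zigzag path in \<open>M\<close>, where the axioms of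
  \<open>d\<close> are available.\<close>

lemma dpath_in_space:
  assumes "directed_structure mtopology P" "\<gamma> \<in> P" "t \<in> {0..1}"
  shows "\<gamma> t \<in> M"
proof -
  have "pathin mtopology \<gamma>"
    using assms directed_structure.dpaths_are_paths by (fastforce simp: paths_def)
  then show ?thesis
    using assms(3) path_image_subset_topspace by fastforce
qed

text \<open>The triangle inequality is applied along the nodes \<open>p\<close>. The direction of
  each d-path is irrelevant because \<open>d\<close> is symmetric.\<close>

lemma dist_le_zigzag_len:
  assumes "directed_structure mtopology P" "zigzag_path P x y \<gamma>s"
  shows "ennreal (d x y) \<le> zigzag_len d \<gamma>s"
proof -
  obtain p where p: "p 0 = x" "p (length \<gamma>s) = y" and
    "\<forall>i\<in>{1..length \<gamma>s}. \<gamma>s ! (i - 1) \<in>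
       dpaths_between P (p (i - 1)) (p i) \<union> dpaths_between P (p i) (p (i - 1))"
    and ne: "\<gamma>s \<noteq> []"
    using assms(2) unfolding zigzag_path_def by blast
  then have step: "\<gamma>s ! i \<in> dpaths_between P (p i) (p (Suc i)) \<union> dpaths_between P (p (Suc i)) (p i)"
    if "i < length \<gamma>s" for i
    using that by (metis Suc_le_eq atLeastAtMost_iff diff_Suc_1 le_add1 plus_1_eq_Suc)
  have edge: "p i \<in> M" "p (Suc i) \<in> M" "ennreal (d (p i) (p (Suc i))) \<le> path_len d (\<gamma>s ! i)"
    if "i < length \<gamma>s" for i
    using step[OF that] path_len_ge_dist[of "\<gamma>s ! i"]
      dpath_in_space[OF assms(1), of "\<gamma>s ! i" 0] dpath_in_space[OF assms(1), of "\<gamma>s ! i" 1]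
    by (auto simp: dpaths_between_def commute)
  have "ennreal (d x (p n)) \<le> zigzag_len d (take n \<gamma>s)" if "n \<le> length \<gamma>s" for n
    using that
  proof (induction n)
    case 0
    \<comment> \<open>A nonempty list has a first edge, which puts \<open>x\<close> in
      \<open>M\<close> and so makes \<open>d x x\<close> vanish.\<close>
    then show ?case using p ne edge(1)[of 0] by (simp add: zigzag_len_def)
  next
    case (Suc n)
    then have n: "n < length \<gamma>s" by simp
    have "x \<in> M" using p ne edge(1)[of 0] by simp
    then have "ennreal (d x (p (Suc n))) \<le> ennreal (d x (p n) + d (p n) (p (Suc n)))"
      using edge[OF n] triangle by (intro ennreal_leI) auto
    also have "\<dots> = ennreal (d x (p n)) + ennreal (d (p n) (p (Suc n)))"
      by simp
    also have "\<dots> \<le> zigzag_len d (take n \<gamma>s) + path_len d (\<gamma>s ! n)"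
      using Suc n edge(3)[OF n] by (intro add_mono) auto
    also have "\<dots> = zigzag_len d (take (Suc n) \<gamma>s)"
      using n by (simp add: zigzag_len_def take_Suc_conv_app_nth)
    finally show ?case .
  qed
  from this[of "length \<gamma>s"] show ?thesis using p by simp
qed

end

text \<open>Only the order of the list is reversed. The d-paths themselves are kept, since their
  reversals need not be d-paths and each step admits both directions.\<close>

lemma zigzag_path_rev:
  assumes "zigzag_path P x y \<gamma>s"
  shows "zigzag_path P y x (rev \<gamma>s)"
proof -
  let ?n = "length \<gamma>s"
  obtain p where p: "p 0 = x" "p ?n = y" and
    step: "\<forall>i\<in>{1..?n}. \<gamma>s ! (i - 1) \<in>
       dpaths_between P (p (i - 1)) (p i) \<union> dpaths_between P (p i) (p (i - 1))"
    and ne: "\<gamma>s \<noteq> []"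
    using assms unfolding zigzag_path_def by blast
  have "rev \<gamma>s ! (i - 1) \<in>
      dpaths_between P (p (?n - (i - 1))) (p (?n - i)) \<union>
      dpaths_between P (p (?n - i)) (p (?n - (i - 1)))" if "i \<in> {1..?n}" for i
  proof -
    have "?n - (i - 1) \<in> {1..?n}" "?n - (i - 1) - 1 = ?n - i" "rev \<gamma>s ! (i - 1) = \<gamma>s ! (?n - i)"
      using that by (auto simp: rev_nth)
    then show ?thesis using step by (metis Un_commute)
  qed
  then show ?thesis
    using p ne unfolding zigzag_path_def by (intro conjI exI[of _ "\<lambda>i. p (?n - i)"]) auto
qed

lemma zigzag_path_append:
  assumes "zigzag_path P x y \<gamma>s" "zigzag_path P y z \<gamma>s'"
  shows "zigzag_path P x z (\<gamma>s @ \<gamma>s')"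
proof -
  let ?n = "length \<gamma>s"
  obtain p where p: "p 0 = x" "p ?n = y" and
    step: "\<forall>i\<in>{1..?n}. \<gamma>s ! (i - 1) \<in>
       dpaths_between P (p (i - 1)) (p i) \<union> dpaths_between P (p i) (p (i - 1))"
    using assms(1) unfolding zigzag_path_def by blast
  obtain q where q: "q 0 = y" "q (length \<gamma>s') = z" and
    step': "\<forall>i\<in>{1..length \<gamma>s'}. \<gamma>s' ! (i - 1) \<in>
       dpaths_between P (q (i - 1)) (q i) \<union> dpaths_between P (q i) (q (i - 1))"
    using assms(2) unfolding zigzag_path_def by blast
  define r where "r i = (if i \<le> ?n then p i else q (i - ?n))" for i
  \<comment> \<open>At the seam \<open>i = ?n\<close> both descriptions give \<open>y\<close>. The
    first step of \<open>\<gamma>s'\<close> needs this, as its node \<open>r (i - 1)\<close> is the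
    seam.\<close>
  have r: "r i = q (i - ?n)" if "?n \<le> i" for i
    using that p q by (auto simp: r_def)
  have "(\<gamma>s @ \<gamma>s') ! (i - 1) \<in> dpaths_between P (r (i - 1)) (r i) \<union> dpaths_between P (r i) (r (i - 1))"
    if "i \<in> {1..length (\<gamma>s @ \<gamma>s')}" for i
  proof (cases "i \<le> ?n")
    case True
    then show ?thesis using that step by (auto simp: r_def nth_append)
  next
    case False
    then have "(\<gamma>s @ \<gamma>s') ! (i - 1) = \<gamma>s' ! (i - ?n - 1)" "i - ?n \<in> {1..length \<gamma>s'}"
      "r i = q (i - ?n)" "r (i - 1) = q (i - ?n - 1)"
      using that r[of i] r[of "i - 1"] by (auto simp: nth_append diff_commute)
    then show ?thesis using step' by metis
  qed
  moreover have "r 0 = x" "r (length (\<gamma>s @ \<gamma>s')) = z"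
    using p q r[of "length (\<gamma>s @ \<gamma>s')"] by (auto simp: r_def)
  ultimately show ?thesis
    using assms unfolding zigzag_path_def by blast
qed

lemma zigzag_dist_le: "zigzag_path P x y \<gamma>s \<Longrightarrow> zigzag_dist d P x y \<le> zigzag_len d \<gamma>s"
  unfolding zigzag_dist_def by (auto intro: INF_lower)

lemma zigzag_dist_commute: "zigzag_dist d P x y = zigzag_dist d P y x"
proof -
  have "zigzag_dist d P x y \<le> zigzag_dist d P y x" for x y
    unfolding zigzag_dist_def[of d P y x]
  proof (rule INF_greatest, clarify)
    fix \<gamma>s assume "zigzag_path P y x \<gamma>s"
    then have "zigzag_dist d P x y \<le> zigzag_len d (rev \<gamma>s)"
      by (intro zigzag_dist_le zigzag_path_rev)
    then show "zigzag_dist d P x y \<le> zigzag_len d \<gamma>s"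
      by (simp add: zigzag_len_def flip: rev_map)
  qed
  then show ?thesis by (intro antisym)
qed

text \<open>For finite \<open>b\<close>, subtraction moves \<open>b\<close> to the left, so that
  \<open>a - b\<close> is a lower bound of the family. An empty \<open>I\<close>, as when no zigzag
  path exists, is covered: its infimum is \<open>top\<close>.\<close>

lemma ennreal_le_add_INF:
  fixes a b :: ennreal
  assumes "\<And>i. i \<in> I \<Longrightarrow> a \<le> b + f i"
  shows "a \<le> b + (INF i\<in>I. f i)"
proof (cases "b = top")
  case False
  then have "a - b \<le> (INF i\<in>I. f i)"
    using assms by (intro INF_greatest) (simp add: ennreal_minus_le_iff)
  then show ?thesis by (simp add: ennreal_minus_le_iff)
qed simp

text \<open>Lengths add under concatenation, and the two infima are taken one at a time: first over
  \<open>\<gamma>s'\<close> with \<open>\<gamma>s\<close> fixed, then over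
  \<open>\<gamma>s\<close>.\<close>

lemma zigzag_dist_triangle: "zigzag_dist d P x z \<le> zigzag_dist d P x y + zigzag_dist d P y z"
proof -
  have "zigzag_dist d P x z \<le> zigzag_len d \<gamma>s + zigzag_len d \<gamma>s'"
    if "zigzag_path P x y \<gamma>s" "zigzag_path P y z \<gamma>s'" for \<gamma>s \<gamma>s'
    using zigzag_dist_le[OF zigzag_path_append[OF that]] by (simp add: zigzag_len_def)
  then have "zigzag_dist d P x z \<le> zigzag_dist d P y z + zigzag_len d \<gamma>s" if "zigzag_path P x y \<gamma>s" for \<gamma>s
    using that unfolding zigzag_dist_def[of d P y z]
    \<comment> \<open>The swap brings the infimum to the right summand, where
      \<open>ennreal_le_add_INF\<close> expects it.\<close>
    by (subst add.commute) (auto intro: ennreal_le_add_INF)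
  then show ?thesis
    unfolding zigzag_dist_def[of d P x y]
    by (subst add.commute) (auto intro: ennreal_le_add_INF)
qed

theorem proposition3p1:
  fixes M :: "'a set" and d :: "'a \<Rightarrow> 'a \<Rightarrow> real" and P :: "(real \<Rightarrow> 'a) set"
  assumes "Metric_space M d"
    and "directed_structure (Metric_space.mtopology M d) P"
    and "\<forall>\<gamma>\<in>P. rectifiable d \<gamma>"
  shows "extended_metric M (zigzag_dist d P)"
proof
  interpret Metric_space M d by fact
  fix x y assume xy: "x \<in> M" "y \<in> M"
  show "zigzag_dist d P x y = 0 \<longleftrightarrow> x = y"
  proof
    assume "zigzag_dist d P x y = 0"
    moreover have "ennreal (d x y) \<le> zigzag_dist d P x y"
      unfolding zigzag_dist_def using dist_le_zigzag_len[OF assms(2)] by (auto intro: INF_greatest)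
    ultimately show "x = y" using xy by simp
  next
    assume "x = y"
    let ?c = "\<lambda>t\<in>{0..1::real}. x"
    have "?c \<in> P"
      using directed_structure.constant_paths[OF assms(2)] xy by simp
    \<comment> \<open>Zigzag paths are nonempty lists, so the constant d-path serves as the one of
      length 0 from \<open>x\<close> to itself.\<close>
    then have "zigzag_path P x x [?c]"
      unfolding zigzag_path_def by (intro conjI exI[of _ "\<lambda>_. x"]) (auto simp: dpaths_between_def)
    from zigzag_dist_le[OF this, of d] show "zigzag_dist d P x y = 0"
      using \<open>x = y\<close> xy by (simp add: zigzag_len_def path_len_constant)
  qed
qed (rule zigzag_dist_commute zigzag_dist_triangle)+

end
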